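(* Let $K=\mathbb{F}_q$ be a finite field with $q$ elements. Let $\mathcal{C}$ be a clutter with vertex set $\{y_1,\ldots,y_n\}$ and with $s\geq 1$ edges, let $v_1,\ldots,v_s$ be the characteristic vectors of the edges of $\mathcal{C}$, let $X\subset\mathbb{P}^{s-1}$ be the algebraic toric set parameterized by $y^{v_1},\ldots,y^{v_s}$, and let $I(X)\subset S=K[t_1,\ldots,t_s]$ be its vanishing ideal. Then $$\mathrm{reg}(S/I(X))\leq (q-2)(s-1),$$ with equality if $I(X)$ is a complete intersection.
   Context: A clutter $\mathcal{C}$ is a family $E$ of subsets (called edges) of a finite ground set $Y=\{y_1,\ldots,y_n\}$ (the vertex set) such that if $f_1,f_2\in E$ are distinct, then $f_1\not\subset f_2$. The characteristic vector of an edge $f$ is $\sum_{y_i\in f}e_i$, where $e_i$ is the $i$-th unit vector in $\mathbb{R}^n$; $v_1,\ldots,v_s$ is the list of the (distinct) characteristic vectors of all edges of $\mathcal{C}$, and $v_i=(v_{i1},\ldots,v_{in})\in\mathbb{N}^n$, where $\mathbb{N}$ includes $0$. With $K^*=K\setminus\{0\}$ and $\mathbb{P}^{s-1}$ the projective space of dimension $s-1$ over $K$, the algebraic toric set parameterized by $y^{v_1},\ldots,y^{v_s}$ is $$X=\{[(x_1^{v_{11}}\cdots x_n^{v_{1n}},\ldots,x_1^{v_{s1}}\cdots x_n^{v_{sn}})]\in\mathbb{P}^{s-1}\mid x_i\in K^*\text{ for all }i\}.$$ $S=K[t_1,\ldots,t_s]=\bigoplus_{d\geq 0}S_d$ has the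 standard grading; $I(X)$ is the ideal of $S$ generated by the homogeneous polynomials of $S$ that vanish on $X$. The ideal $I(X)$ is called a complete intersection if it can be generated by $s-1$ homogeneous polynomials of $S$. The Hilbert function of $S/I(X)$ is $H_X(d)=\dim_K(S_d/I(X)_d)$, where $I(X)_d=I(X)\cap S_d$. The Hilbert polynomial $h_X$ is the unique polynomial with $h_X(d)=H_X(d)$ for $d\gg 0$ (here it is the constant $|X|$). The regularity (index of regularity) $\mathrm{reg}(S/I(X))$ is the least integer $p\geq 0$ such that $h_X(d)=H_X(d)$ for all $d\geq p$. *)

theory Defs
  imports Complex_Main "HOL-Library.Poly_Mapping" "HOL-Library.Indicator_Function"
    "HOL-Library.Cardinality" "HOL-Computational_Algebra.Polynomial"
begin

definition clutter :: "'v set \<Rightarrow> 'v set set \<Rightarrow> bool" where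
  "clutter Y E \<longleftrightarrow> finite Y \<and> E \<subseteq> Pow Y \<and>
     (\<forall>f1\<in>E. \<forall>f2\<in>E. f1 \<noteq> f2 \<longrightarrow> \<not> f1 \<subseteq> f2)"

text \<open>The type \<open>'s\<close> indexes the \<open>s = CARD('s)\<close> homogeneous coordinates and the
  variables \<open>t\<^sub>1, \<dots>, t\<^sub>s\<close>. A point of the projective space is the class of a nonzero
  vector, that is, the set of all its nonzero scalar multiples.\<close>

definition proj_point :: "('s \<Rightarrow> 'k::field) \<Rightarrow> ('s \<Rightarrow> 'k) set" where
  "proj_point a = {(\<lambda>i. c * a i) | c. c \<noteq> 0}"

definition toric_set :: "'v set \<Rightarrow> ('s \<Rightarrow> 'v \<Rightarrow> nat) \<Rightarrow> ('s \<Rightarrow> 'k::field) set set" where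
  "toric_set Y v =
     {proj_point (\<lambda>i. \<Prod>y\<in>Y. x y ^ v i y) | x. \<forall>y\<in>Y. x y \<noteq> 0}"

text \<open>\<open>K[t\<^sub>1, \<dots>, t\<^sub>s]\<close>: finitely supported functions from exponent vectors to
  coefficients, with the convolution product.\<close>

type_synonym ('s, 'k) mpoly = "('s \<Rightarrow>\<^sub>0 nat) \<Rightarrow>\<^sub>0 'k"

definition eval_mpoly :: "('s::finite \<Rightarrow> 'k::comm_ring_1) \<Rightarrow> ('s, 'k) mpoly \<Rightarrow> 'k" where
  "eval_mpoly a p =
     (\<Sum>m\<in>Poly_Mapping.keys p. Poly_Mapping.lookup p m * (\<Prod>i\<in>UNIV. a i ^ Poly_Mapping.lookup m i))"

definition scale_mpoly :: "'k::comm_ring_1 \<Rightarrow> ('s, 'k) mpoly \<Rightarrow> ('s, 'k) mpoly" where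
  "scale_mpoly c p = Poly_Mapping.single 0 c * p"

definition graded_part :: "nat \<Rightarrow> ('s::finite, 'k::comm_ring_1) mpoly set" where
  "graded_part d = {p. \<forall>m\<in>Poly_Mapping.keys p. (\<Sum>i\<in>UNIV. Poly_Mapping.lookup m i) = d}"

definition homogeneous :: "('s::finite, 'k::comm_ring_1) mpoly \<Rightarrow> bool" where
  "homogeneous p \<longleftrightarrow> (\<exists>d. p \<in> graded_part d)"

definition ideal_gen :: "'a::comm_ring_1 set \<Rightarrow> 'a set" where
  "ideal_gen B = module.span (*) B"

definition vanishing_ideal :: "('s::finite \<Rightarrow> 'k::field) set set \<Rightarrow> ('s, 'k) mpoly set" where
  "vanishing_ideal X =
     ideal_gen {p. homogeneous p \<and> (\<forall>P\<in>X. \<forall>a\<in>P. eval_mpoly a p = 0)}"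

definition complete_intersection :: "('s::finite, 'k::field) mpoly set \<Rightarrow> bool" where
  "complete_intersection I \<longleftrightarrow>
     (\<exists>g :: nat \<Rightarrow> ('s, 'k) mpoly.
        (\<forall>i < CARD('s) - 1. homogeneous (g i)) \<and> I = ideal_gen (g ` {..< CARD('s) - 1}))"

text \<open>\<open>B\<close> is a set of representatives, in \<open>U\<close>, of a finite basis of the quotient space \<open>U / W\<close>.
  Independence modulo \<open>W\<close> makes distinct elements of \<open>B\<close> have distinct classes, so that
  \<open>card B\<close> is the number of basis elements.\<close>

definition quotient_basis ::
    "('s, 'k::field) mpoly set \<Rightarrow> ('s, 'k) mpoly set \<Rightarrow> ('s, 'k) mpoly set \<Rightarrow> bool" where
  "quotient_basis U W B \<longleftrightarrow> finite B \<and> B \<subseteq> U \<and>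
     (\<forall>c. (\<Sum>b\<in>B. scale_mpoly (c b) b) \<in> W \<longrightarrow> (\<forall>b\<in>B. c b = 0)) \<and>
     (\<forall>u\<in>U. \<exists>c. u - (\<Sum>b\<in>B. scale_mpoly (c b) b) \<in> W)"

definition quotient_dim :: "('s, 'k::field) mpoly set \<Rightarrow> ('s, 'k) mpoly set \<Rightarrow> nat" where
  "quotient_dim U W = (THE r. \<exists>B. quotient_basis U W B \<and> card B = r)"

text \<open>The invariants below belong to the quotient ring \<open>S / I\<close>.\<close>

definition hilbert_function :: "('s::finite, 'k::field) mpoly set \<Rightarrow> nat \<Rightarrow> nat" where
  "hilbert_function I d = quotient_dim (graded_part d) (I \<inter> graded_part d)"

definition hilbert_polynomial :: "('s::finite, 'k::field) mpoly set \<Rightarrow> rat poly" where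
  "hilbert_polynomial I =
     (THE h. \<forall>\<^sub>F d in sequentially. poly h (of_nat d) = of_nat (hilbert_function I d))"

definition regularity :: "('s::finite, 'k::field) mpoly set \<Rightarrow> nat" where
  "regularity I =
     (LEAST p. \<forall>d\<ge>p. poly (hilbert_polynomial I) (of_nat d) = of_nat (hilbert_function I d))"

end

theory Submission
  imports Defs "Jordan_Normal_Form.Determinant"
begin

text \<open>
Write \<open>q\<close> for the order of the field and \<open>s\<close> for the number of edges. The points of \<open>X\<close> are
represented by a subgroup \<open>A\<close> of the torus \<open>(K - {0})\<^sup>s\<close>, so every monomial is a character of \<open>A\<close>.
Distinct characters are linearly independent, hence a form of degree \<open>d\<close> lies in \<open>I(X)\<close> exactly when its
coefficients add up to zero over each class of monomials that define the same character, and
\<open>H\<^sub>X(d)\<close> is the number of characters given by monomials of degree \<open>d\<close> (\<open>hilbert_function_I\<close>).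

Multiplication by a fixed variable \<open>t\<^sub>i\<close> embeds the characters of degree \<open>d\<close> into those of degree
\<open>d + 1\<close>. Since \<open>t\<^sub>j\<close> and \<open>t\<^sub>i\<close> have the same \<open>(q - 1)\<close>-st power on \<open>A\<close>, the embedding is onto as soon as
every monomial of degree \<open>d + 1\<close> contains \<open>t\<^sub>i\<close> or a \<open>(q - 1)\<close>-st power, that is for
\<open>d \<ge> (q - 2)(s - 1)\<close> (\<open>shift_surj\<close>). This is the upper bound.

For a clutter, any two coordinates \<open>i \<noteq> j\<close> are separated by a vertex lying in the \<open>i\<close>-th edge but not
in the \<open>j\<close>-th; it gives a one-parameter subgroup of \<open>A\<close> with exponents \<open>0\<close> and \<open>1\<close>. Because of these
subgroups no form in \<open>I(X)\<close> contains a pure power \<open>t\<^sub>i\<^sup>d\<close> with \<open>d < q - 1\<close>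
(\<open>no_low_pure_power\<close>). Now let \<open>s - 1\<close> forms generate \<open>I(X)\<close>, and fix one variable \<open>t\<^sub>0\<close>. The \<open>s - 1\<close>
binomials \<open>t\<^sub>i\<^sup>q\<^sup>-\<^sup>1 - t\<^sub>0\<^sup>q\<^sup>-\<^sup>1\<close> with \<open>i \<noteq> 0\<close> are combinations of the generators; comparing
coefficients at pure powers of degree \<open>q - 1\<close>, where only the constant terms of the multipliers count,
yields an identity \<open>C P = 1\<close> of square matrices. Then also \<open>P C = 1\<close>, which expresses the generators
through the binomials (\<open>generator_support\<close>). So \<open>I(X)\<close> is generated by polynomials supported on
\<open>(q - 1)\<close>-st powers, and the product of all \<open>t\<^sub>i\<^sup>q\<^sup>-\<^sup>2\<close> with \<open>i \<noteq> 0\<close> occurs in none of its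
elements. In particular it is not congruent to a multiple of \<open>t\<^sub>0\<close>, so the Hilbert function still grows in
the step to degree \<open>(q - 2)(s - 1)\<close> (\<open>degree_characters_strict\<close>).
\<close>

abbreviation "lookup \<equiv> Poly_Mapping.lookup"
abbreviation "keys \<equiv> Poly_Mapping.keys"
abbreviation "single \<equiv> Poly_Mapping.single"

section \<open>Powers in a finite field\<close>

text \<open>Multiplication by \<open>x\<close> permutes the nonzero elements, so it does not change their product.\<close>

lemma finite_field_power_pred_card:
  fixes x :: "'k::{field,finite}"
  assumes "x \<noteq> 0"
  shows "x ^ (CARD('k) - 1) = 1"
proof -
  let ?U = "UNIV - {0::'k}"
  have "bij_betw ((*) x) ?U ?U"
    by (rule bij_betw_byWitness[where f' = "\<lambda>y. y / x"]) (use assms in auto)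
  then have "prod (\<lambda>y. x * y) ?U = prod (\<lambda>y. y) ?U"
    by (rule prod.reindex_bij_betw)
  then have "x ^ card ?U * prod (\<lambda>y. y) ?U = prod (\<lambda>y. y) ?U"
    by (simp add: prod.distrib)
  moreover have "prod (\<lambda>y. y) ?U \<noteq> 0"
    by simp
  ultimately show ?thesis
    by (simp add: card_Diff_singleton)
qed

lemma finite_field_card_ge_2: "CARD('k::{field,finite}) \<ge> 2"
proof -
  have "card {0, 1 :: 'k} \<le> CARD('k)"
    by (intro card_mono) auto
  then show ?thesis by simp
qed

text \<open>Otherwise the nonzero polynomial \<open>T\<^sup>d\<^sup>-\<^sup>e - 1\<close> has more roots than its degree.\<close>

lemma finite_field_power_eq_imp:
  assumes eq: "\<And>x::'k::{field,finite}. x \<noteq> 0 \<Longrightarrow> x ^ d = x ^ e" and "e < d"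
  shows "CARD('k) - 1 \<le> d"
proof -
  let ?p = "[:- 1:] + monom (1::'k) (d - e)"
  have deg: "degree ?p = d - e"
    using \<open>e < d\<close> by (subst degree_add_eq_right) (auto simp: degree_monom_eq)
  then have "?p \<noteq> 0"
    using \<open>e < d\<close> by (metis degree_0 less_irrefl zero_less_diff)
  have "x ^ (d - e) = 1" if "x \<noteq> 0" for x :: 'k
    using eq[OF that] that \<open>e < d\<close> power_diff[of x e d] by simp
  then have "UNIV - {0} \<subseteq> {x. poly ?p x = 0}"
    by (auto simp: poly_monom)
  then have "card (UNIV - {0::'k}) \<le> card {x. poly ?p x = 0}"
    by (intro card_mono) auto
  also have "\<dots> \<le> d - e"
    using card_poly_roots_bound[OF \<open>?p \<noteq> 0\<close>] deg by simp
  finally show ?thesis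
    by (simp add: card_Diff_singleton)
qed

section \<open>Evaluation and coefficients of polynomials\<close>

definition monomial_value :: "('s::finite \<Rightarrow> 'k::comm_ring_1) \<Rightarrow> ('s \<Rightarrow>\<^sub>0 nat) \<Rightarrow> 'k" where
  "monomial_value a m = (\<Prod>i\<in>UNIV. a i ^ lookup m i)"

lemma monomial_value_add: "monomial_value a (m + n) = monomial_value a m * monomial_value a n"
  by (simp add: monomial_value_def lookup_add power_add prod.distrib)

lemma monomial_value_single [simp]: "monomial_value a (single i n) = a i ^ n"
proof -
  have "a j ^ lookup (single i n) j = (if j = i then a i ^ n else 1)" for j
    by (simp add: lookup_single when_def)
  then show ?thesis
    by (simp add: monomial_value_def)
qed

lemma monomial_value_mult:
  "monomial_value (\<lambda>i. a i * b i) m = monomial_value a m * monomial_value b m"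
  by (simp add: monomial_value_def power_mult_distrib prod.distrib)

abbreviation total_degree :: "('s::finite \<Rightarrow>\<^sub>0 nat) \<Rightarrow> nat" where
  "total_degree m \<equiv> (\<Sum>i\<in>UNIV. lookup m i)"

lemma total_degree_add: "total_degree (m + n) = total_degree m + total_degree n"
  by (simp add: lookup_add sum.distrib)

lemma total_degree_single [simp]: "total_degree (single i n) = n"
proof -
  have "lookup (single i n) j = (if j = i then n else 0)" for j
    by (simp add: lookup_single when_def)
  then show ?thesis by simp
qed

lemma monomial_value_scale:
  "monomial_value (\<lambda>i. c * a i) m = c ^ total_degree m * monomial_value a m"
  by (simp add: monomial_value_def power_mult_distrib prod.distrib power_sum)

lemma eval_mpoly_superset:
  assumes "finite M" "keys p \<subseteq> M"
  shows "eval_mpoly a p = (\<Sum>m\<in>M. lookup p m * monomial_value a m)"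
  unfolding eval_mpoly_def monomial_value_def
  by (rule sum.mono_neutral_left) (use assms in \<open>auto simp: in_keys_iff\<close>)

lemma eval_mpoly_eq: "eval_mpoly a p = (\<Sum>m\<in>keys p. lookup p m * monomial_value a m)"
  by (rule eval_mpoly_superset) auto

lemma eval_mpoly_0 [simp]: "eval_mpoly a 0 = 0"
  by (simp add: eval_mpoly_eq)

lemma eval_mpoly_single [simp]: "eval_mpoly a (single m c) = c * monomial_value a m"
  by (subst eval_mpoly_superset[of "{m}"]) (auto simp: keys_single)

lemma eval_mpoly_add: "eval_mpoly a (p + q) = eval_mpoly a p + eval_mpoly a q"
proof -
  have "eval_mpoly a r = (\<Sum>m\<in>keys p \<union> keys q. lookup r m * monomial_value a m)"
    if "r \<in> {p, q, p + q}" for r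
    using that keys_add[of p q] by (intro eval_mpoly_superset) auto
  then show ?thesis
    by (simp add: lookup_add algebra_simps sum.distrib)
qed

lemma eval_mpoly_sum: "eval_mpoly a (\<Sum>x\<in>F. f x) = (\<Sum>x\<in>F. eval_mpoly a (f x))"
  by (induction F rule: infinite_finite_induct) (auto simp: eval_mpoly_add)

lemma eval_mpoly_diff: "eval_mpoly a (p - q) = eval_mpoly a p - eval_mpoly a q"
  using eval_mpoly_add[of a "p - q" q] by simp

lemma sum_single_keys: "(\<Sum>m\<in>keys p. single m (lookup p m)) = p"
  by (rule poly_mapping_eqI) (auto simp: lookup_sum lookup_single when_def in_keys_iff)

lemma eval_mpoly_mult: "eval_mpoly a (p * q) = eval_mpoly a p * eval_mpoly a q"
proof -
  have "p * q = (\<Sum>m\<in>keys p. \<Sum>n\<in>keys q. single (m + n) (lookup p m * lookup q n))"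
    by (subst (1 2) sum_single_keys[symmetric]) (simp add: sum_product mult_single)
  then show ?thesis
    by (simp add: eval_mpoly_sum monomial_value_add eval_mpoly_eq[of a p] eval_mpoly_eq[of a q]
        sum_product mult_ac)
qed

lemma scale_mpoly_diff_left: "scale_mpoly (c - d) p = scale_mpoly c p - scale_mpoly d p"
  by (simp add: scale_mpoly_def single_diff algebra_simps)

lemma scale_mpoly_single [simp]: "scale_mpoly c (single m d) = single m (c * d)"
  by (simp add: scale_mpoly_def mult_single)

lemma lookup_mult_eq_0:
  assumes "\<And>k l. m = k + l \<Longrightarrow> lookup q l = 0"
  shows "lookup (p * q) m = 0"
proof -
  have "Sum_any (\<lambda>l. lookup q l when m = k + l) = 0" for k
  proof -
    have "(\<lambda>l. lookup q l when m = k + l) = (\<lambda>_. 0)"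
      using assms by (auto simp: when_def)
    then show ?thesis by (simp only: Sum_any.neutral)
  qed
  then show ?thesis
    by (simp add: lookup_mult)
qed

text \<open>When only the constant term of \<open>p\<close> can contribute to the coefficient at \<open>m\<close>, the coefficient of
the product depends on \<open>p\<close> through a scalar. This turns relations between generators with polynomial
multipliers into linear algebra over the field.\<close>

lemma lookup_mult_constant:
  assumes "\<And>k l. m = k + l \<Longrightarrow> k \<noteq> 0 \<Longrightarrow> lookup q l = 0"
  shows "lookup (p * q) m = lookup p 0 * lookup q m"
proof -
  have "Sum_any (\<lambda>l. lookup q l when m = k + l) = (lookup q m when k = 0)" for k
  proof (cases "k = 0")
    case False
    then have "(\<lambda>l. lookup q l when m = k + l) = (\<lambda>_. 0)"
      using assms[of k] by (auto simp: when_def)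
    then have "Sum_any (\<lambda>l. lookup q l when m = k + l) = 0"
      by (simp only: Sum_any.neutral)
    with False show ?thesis by simp
  qed simp
  then show ?thesis
    by (simp add: lookup_mult mult_when)
qed

lemma lookup_scale_mpoly [simp]: "lookup (scale_mpoly c p) m = c * lookup p m"
  by (simp add: scale_mpoly_def lookup_mult lookup_single when_mult)

lemma total_degree_eq_0_iff: "total_degree m = 0 \<longleftrightarrow> m = 0"
  by (auto intro!: poly_mapping_eqI)

lemma single_eq_addD:
  fixes k l :: "'s \<Rightarrow>\<^sub>0 nat"
  assumes "single i n = k + l"
  shows "l = single i (lookup l i)" "n = lookup k i + lookup l i" "k = 0 \<longleftrightarrow> lookup k i = 0"
proof -
  have eq: "lookup (single i n) j = lookup k j + lookup l j" for j
    by (simp add: assms lookup_add)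
  have 0: "lookup k j = 0" "lookup l j = 0" if "j \<noteq> i" for j
    using eq[of j] that by (simp_all add: lookup_single when_def)
  show "l = single i (lookup l i)"
    using 0(2) by (intro poly_mapping_eqI) (auto simp: lookup_single when_def)
  show "n = lookup k i + lookup l i"
    using eq[of i] by simp
  show "k = 0 \<longleftrightarrow> lookup k i = 0"
    using 0(1) by (metis lookup_zero poly_mapping_eqI)
qed

lemma exponent_split:
  fixes m :: "'s \<Rightarrow>\<^sub>0 nat"
  assumes "k \<le> lookup m i"
  obtains n where "m = n + single i k"
proof -
  have "m = (m - single i k) + single i k"
    by (rule poly_mapping_eqI) (use assms in \<open>auto simp: lookup_add lookup_minus lookup_single when_def\<close>)
  then show ?thesis using that by blast
qed

section \<open>Ideals and dimensions of quotient spaces\<close>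

interpretation ring_module: Modules.module "(*) :: 'a::comm_ring_1 \<Rightarrow> 'a \<Rightarrow> 'a"
  by unfold_locales (simp_all add: algebra_simps)

lemma ideal_gen_induct [consumes 1, case_names zero step]:
  assumes "x \<in> ideal_gen B" and "P 0"
    and "\<And>c b y. b \<in> B \<Longrightarrow> P y \<Longrightarrow> P (c * b + y)"
  shows "P x"
  using assms unfolding ideal_gen_def by (rule ring_module.span_induct_alt)

lemma ideal_gen_image_obtain:
  fixes g :: "nat \<Rightarrow> 'a::comm_ring_1"
  assumes "x \<in> ideal_gen (g ` {..<n})"
  obtains h where "x = (\<Sum>k<n. h k * g k)"
proof -
  have "\<exists>h. x = (\<Sum>k<n. h k * g k)"
    using assms
  proof (induction rule: ideal_gen_induct)
    case zero
    show ?case by (rule exI[of _ "\<lambda>_. 0"]) simp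
  next
    case (step c b y)
    then obtain k h where k: "k < n" "b = g k" "y = (\<Sum>k<n. h k * g k)"
      by auto
    have "(\<Sum>l<n. (h(k := h k + c)) l * g l) = (\<Sum>l<n. h l * g l + (if l = k then c * g k else 0))"
      by (rule sum.cong) (auto simp: algebra_simps)
    also have "\<dots> = c * b + y"
      using k by (simp add: sum.distrib)
    finally show ?case by metis
  qed
  then show ?thesis using that by blast
qed

lemma graded_partD: "p \<in> graded_part d \<Longrightarrow> total_degree m \<noteq> d \<Longrightarrow> lookup p m = 0"
  by (auto simp: graded_part_def in_keys_iff)

lemma single_in_graded_part: "total_degree m = d \<Longrightarrow> single m c \<in> graded_part d"
  by (auto simp: graded_part_def)

lemma graded_part_iff: "p \<in> graded_part d \<longleftrightarrow> (\<forall>m. lookup p m \<noteq> 0 \<longrightarrow> total_degree m = d)"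
  by (auto simp: graded_part_def in_keys_iff)

lemma graded_part_diff: "p \<in> graded_part d \<Longrightarrow> q \<in> graded_part d \<Longrightarrow> p - q \<in> graded_part d"
  unfolding graded_part_def using keys_diff[of p q] by blast

lemma graded_part_combination:
  assumes "B \<subseteq> graded_part d"
  shows "(\<Sum>b\<in>B. scale_mpoly (c b) b) \<in> graded_part d"
  unfolding graded_part_iff lookup_sum
proof (intro allI impI)
  fix m
  assume "(\<Sum>b\<in>B. lookup (scale_mpoly (c b) b) m) \<noteq> 0"
  then obtain b where "b \<in> B" "lookup (scale_mpoly (c b) b) m \<noteq> 0"
    by (rule sum.not_neutral_contains_not_neutral)
  moreover from this have "lookup b m \<noteq> 0"
    by auto
  ultimately show "total_degree m = d"
    using assms graded_partD by blast
qed

lemma eval_mpoly_scale_point: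
  assumes "p \<in> graded_part d"
  shows "eval_mpoly (\<lambda>i. c * a i) p = c ^ d * eval_mpoly a p"
proof -
  have "lookup p m * monomial_value (\<lambda>i. c * a i) m = c ^ d * (lookup p m * monomial_value a m)"
    if "m \<in> keys p" for m
  proof -
    have "total_degree m = d"
      using assms that by (auto simp: graded_part_def)
    then show ?thesis
      by (simp add: monomial_value_scale)
  qed
  then show ?thesis
    by (simp add: eval_mpoly_eq sum_distrib_left)
qed

text \<open>Over a field with \<open>q\<close> elements, a quotient space with a basis of \<open>r\<close> elements has
  \<open>q\<^sup>r\<close> elements. Counting cosets is thus enough to see that \<open>r\<close> does not depend on the basis.\<close>

lemma quotient_basis_card_cosets:
  fixes U W :: "('s::finite, 'k::{field,finite}) mpoly set"
  assumes basis: "quotient_basis U W B"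
    and W0: "0 \<in> W" and W: "\<And>x y. x \<in> W \<Longrightarrow> y \<in> W \<Longrightarrow> x - y \<in> W"
    and U: "\<And>c. (\<Sum>b\<in>B. scale_mpoly (c b) b) \<in> U"
  shows "card ((\<lambda>u. {w. u - w \<in> W}) ` U) = CARD('k) ^ card B"
proof -
  let ?coset = "\<lambda>u. {w. u - w \<in> W}"
  let ?comb = "\<lambda>c. \<Sum>b\<in>B. scale_mpoly (c b) b"
  have coset_eq: "?coset u = ?coset w \<longleftrightarrow> u - w \<in> W" for u w
  proof
    assume "?coset u = ?coset w"
    then have "u - w \<in> W \<longleftrightarrow> w - w \<in> W"
      by (simp only: set_eq_iff mem_Collect_eq)
    then show "u - w \<in> W"
      using W0 by simp
  next
    assume uw: "u - w \<in> W"
    then have wu: "w - u \<in> W"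
      using W[OF W0 uw] by simp
    have "(u - x) - (u - w) = w - x" "(w - x) - (w - u) = u - x" for x
      by (simp_all add: algebra_simps)
    then have "u - x \<in> W \<longleftrightarrow> w - x \<in> W" for x
      using W[of "u - x" "u - w"] W[of "w - x" "w - u"] uw wu by metis
    then show "?coset u = ?coset w" by (intro Collect_cong)
  qed
  have fin: "finite B"
    and indep: "\<And>c. ?comb c \<in> W \<Longrightarrow> \<forall>b\<in>B. c b = 0"
    and spans: "\<And>u. u \<in> U \<Longrightarrow> \<exists>c. u - ?comb c \<in> W"
    using basis by (auto simp: quotient_basis_def)
  let ?C = "B \<rightarrow>\<^sub>E (UNIV :: 'k set)"
  have "inj_on (\<lambda>c. ?coset (?comb c)) ?C"
  proof (rule inj_onI)
    fix c d assume cd: "c \<in> ?C" "d \<in> ?C" "?coset (?comb c) = ?coset (?comb d)"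
    then have "?comb c - ?comb d \<in> W"
      by (simp only: coset_eq)
    then have "?comb (\<lambda>b. c b - d b) \<in> W"
      by (simp add: scale_mpoly_diff_left sum_subtractf)
    then have "\<forall>b\<in>B. c b = d b"
      using indep[of "\<lambda>b. c b - d b"] by simp
    then show "c = d"
      using cd(1,2) by (auto intro: PiE_ext)
  qed
  then have "card ((\<lambda>c. ?coset (?comb c)) ` ?C) = card ?C"
    by (rule card_image)
  moreover have "(\<lambda>c. ?coset (?comb c)) ` ?C = ?coset ` U"
  proof (intro equalityI subsetI)
    fix z assume "z \<in> ?coset ` U"
    then obtain u where u: "u \<in> U" "z = ?coset u" by blast
    then obtain c where "u - ?comb c \<in> W"
      using spans by blast
    then have "z = ?coset (?comb c)"
      by (simp only: u(2) coset_eq)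
    also have "?comb c = ?comb (restrict c B)"
      by (rule sum.cong) auto
    finally show "z \<in> (\<lambda>c. ?coset (?comb c)) ` ?C"
      by (rule image_eqI[where x = "restrict c B"]) simp
  qed (use U in auto)
  ultimately have "card (?coset ` U) = card ?C"
    by (simp only:)
  also have "card ?C = CARD('k) ^ card B"
    using fin by (simp add: card_PiE)
  finally show ?thesis .
qed

lemma hilbert_function_eq_card:
  fixes I :: "('s::finite, 'k::{field,finite}) mpoly set"
  assumes basis: "quotient_basis (graded_part d) (I \<inter> graded_part d) B"
    and "0 \<in> I" and "\<And>x y. x \<in> I \<Longrightarrow> y \<in> I \<Longrightarrow> x - y \<in> I"
  shows "hilbert_function I d = card B"
proof -
  let ?n = "card ((\<lambda>u. {w. u - w \<in> I \<inter> graded_part d}) ` graded_part d)"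
  have n: "?n = CARD('k) ^ card B'"
    if "quotient_basis (graded_part d) (I \<inter> graded_part d) B'" for B'
    using that
  proof (rule quotient_basis_card_cosets)
    show "0 \<in> I \<inter> graded_part d"
      using assms by (simp add: graded_part_def)
    show "(\<Sum>b\<in>B'. scale_mpoly (c b) b) \<in> graded_part d" for c
      using that by (intro graded_part_combination) (auto simp: quotient_basis_def)
  qed (use assms in \<open>auto intro: graded_part_diff\<close>)
  have "card B' = card B" if "quotient_basis (graded_part d) (I \<inter> graded_part d) B'" for B'
  proof -
    have "CARD('k) ^ card B' = CARD('k) ^ card B"
      using n[OF that] n[OF basis] by simp
    then show ?thesis
      using finite_field_card_ge_2[where 'k = 'k] by simp
  qed
  then have "(\<exists>B'. quotient_basis (graded_part d) (I \<inter> graded_part d) B' \<and> card B' = r)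
      \<longleftrightarrow> r = card B" for r
    using basis by metis
  then show ?thesis
    by (simp add: hilbert_function_def quotient_dim_def)
qed

text \<open>A polynomial that takes the same value at infinitely many numbers is constant.\<close>

lemma hilbert_polynomial_const:
  assumes "\<And>d. d \<ge> D \<Longrightarrow> hilbert_function I d = h"
  shows "hilbert_polynomial I = [:of_nat h:]"
  unfolding hilbert_polynomial_def
proof (rule the_equality)
  show "\<forall>\<^sub>F d in sequentially. poly [:of_nat h:] (of_nat d) = of_nat (hilbert_function I d)"
    using eventually_ge_at_top[of D] by eventually_elim (simp add: assms)
next
  fix p :: "rat poly"
  assume "\<forall>\<^sub>F d in sequentially. poly p (of_nat d) = of_nat (hilbert_function I d)"
  then obtain N where N: "\<And>d. d \<ge> N \<Longrightarrow> poly p (of_nat d) = of_nat (hilbert_function I d)"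
    by (auto simp: eventually_sequentially)
  have "of_nat ` {max N D..} \<subseteq> {x. poly (p - [:of_nat h:]) x = 0}"
    using N assms by auto
  moreover have "infinite (of_nat ` {max N D..} :: rat set)"
    by (simp add: finite_image_iff inj_on_def infinite_Ici)
  ultimately have "infinite {x. poly (p - [:of_nat h:]) x = 0}"
    using finite_subset by blast
  then show "p = [:of_nat h:]"
    using poly_roots_finite[of "p - [:of_nat h:]"] by auto
qed

lemma regularity_le:
  assumes "\<And>d. d \<ge> D \<Longrightarrow> hilbert_function I d = h"
  shows "regularity I \<le> D"
  unfolding regularity_def
  by (rule Least_le) (simp add: assms hilbert_polynomial_const[OF assms])

lemma regularity_gt:
  assumes "\<And>d. d \<ge> D \<Longrightarrow> hilbert_function I d = h" and "hilbert_function I e \<noteq> h"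
  shows "regularity I > e"
proof -
  let ?P = "\<lambda>p. \<forall>d\<ge>p. poly (hilbert_polynomial I) (of_nat d) = of_nat (hilbert_function I d)"
  have "?P D"
    by (simp add: assms hilbert_polynomial_const[OF assms(1)])
  then have "?P (regularity I)"
    unfolding regularity_def by (rule LeastI)
  moreover have "poly (hilbert_polynomial I) (of_nat e) \<noteq> of_nat (hilbert_function I e)"
    using assms(2) by (simp add: hilbert_polynomial_const[OF assms(1)])
  ultimately show ?thesis
    by (meson not_le)
qed

section \<open>Monomials as characters of a subgroup of the torus\<close>

lemma factor_difference: "r * (x * y) - z * (r * x) = r * (y - z) * (x::'a::comm_ring)"
  by (simp add: algebra_simps)

text \<open>\<open>A\<close> consists of chosen affine representatives of the points of the projective set. Closure under
multiplication is the only group axiom that is stated besides the unit: \<open>A\<close> is finite, so inverses are powers.\<close>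

locale torus_subgroup =
  fixes A :: "('s::finite \<Rightarrow> 'k::{field,finite}) set"
  assumes one: "(\<lambda>_. 1) \<in> A"
    and mult: "a \<in> A \<Longrightarrow> b \<in> A \<Longrightarrow> (\<lambda>i. a i * b i) \<in> A"
    and nonzero: "a \<in> A \<Longrightarrow> a i \<noteq> 0"
begin

abbreviation I :: "('s, 'k) mpoly set" where
  "I \<equiv> vanishing_ideal (proj_point ` A)"

text \<open>Restriction to \<open>A\<close> makes two monomials equal as characters precisely when they agree at the points
of \<open>A\<close>, whatever their values elsewhere.\<close>

definition character :: "('s \<Rightarrow>\<^sub>0 nat) \<Rightarrow> ('s \<Rightarrow> 'k) \<Rightarrow> 'k" where
  "character m = restrict (\<lambda>a. monomial_value a m) A"

definition degree_characters :: "nat \<Rightarrow> (('s \<Rightarrow> 'k) \<Rightarrow> 'k) set" where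
  "degree_characters d = character ` {m. total_degree m = d}"

lemma character_eq_iff:
  "character m = character n \<longleftrightarrow> (\<forall>a\<in>A. monomial_value a m = monomial_value a n)"
  by (auto simp: character_def fun_eq_iff restrict_def)

text \<open>Dedekind's argument: comparing the relation at \<open>a b\<close> with \<open>\<psi> b\<close> times the relation at
\<open>a\<close> eliminates the character \<open>\<psi>\<close>.\<close>

lemma characters_independent:
  assumes "C \<subseteq> range character" "\<And>a. a \<in> A \<Longrightarrow> (\<Sum>\<chi>\<in>C. c \<chi> * \<chi> a) = 0" "\<chi> \<in> C"
  shows "c \<chi> = 0"
proof -
  have "\<forall>c. (\<forall>a\<in>A. (\<Sum>\<chi>\<in>C. c \<chi> * \<chi> a) = 0) \<longrightarrow> (\<forall>\<chi>\<in>C. c \<chi> = 0)"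
    using finite[of C] assms(1)
  proof (induction C rule: finite_induct)
    case empty
    show ?case by blast
  next
    case (insert \<psi> C)
    show ?case
    proof (intro allI impI)
      fix c assume "\<forall>a\<in>A. (\<Sum>\<chi>\<in>insert \<psi> C. c \<chi> * \<chi> a) = 0"
      then have c: "(\<Sum>\<chi>\<in>insert \<psi> C. c \<chi> * \<chi> a) = 0" if "a \<in> A" for a
        using that by (rule bspec)
      obtain n where n: "\<psi> = character n"
        using insert.prems by auto
      have "c \<xi> = 0" if \<xi>: "\<xi> \<in> C" for \<xi>
      proof -
        obtain m where m: "\<xi> = character m"
          using insert.prems \<xi> by auto
        have "\<xi> \<noteq> \<psi>"
          using \<xi> insert.hyps by auto
        then obtain b where b: "b \<in> A" "\<xi> b \<noteq> \<psi> b"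
          by (auto simp: m n character_def fun_eq_iff restrict_def split: if_splits)
        have "c \<xi> * (\<xi> b - \<psi> b) = 0"
        proof (rule insert.IH[rule_format, where c = "\<lambda>\<xi>. c \<xi> * (\<xi> b - \<psi> b)"])
          fix a assume a: "a \<in> A"
          let ?ab = "\<lambda>i. a i * b i"
          have multiplicative: "\<xi> ?ab = \<xi> a * \<xi> b" if "\<xi> \<in> insert \<psi> C" for \<xi>
            using insert.prems that a b(1) mult[OF a b(1)]
            by (auto simp: character_def monomial_value_mult)
          have "(\<Sum>\<xi>\<in>insert \<psi> C. c \<xi> * \<xi> ?ab) - \<psi> b * (\<Sum>\<xi>\<in>insert \<psi> C. c \<xi> * \<xi> a) = 0"
            using c[OF mult[OF a b(1)]] c[OF a] by simp
          also have "(\<Sum>\<xi>\<in>insert \<psi> C. c \<xi> * \<xi> ?ab) = (\<Sum>\<xi>\<in>insert \<psi> C. c \<xi> * (\<xi> a * \<xi> b))"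
            by (rule sum.cong[OF refl]) (simp only: multiplicative)
          finally have "(\<Sum>\<xi>\<in>insert \<psi> C. c \<xi> * (\<xi> a * \<xi> b) - \<psi> b * (c \<xi> * \<xi> a)) = 0"
            by (simp only: sum_subtractf sum_distrib_left)
          moreover have "c \<xi> * (\<xi> a * \<xi> b) - \<psi> b * (c \<xi> * \<xi> a) = c \<xi> * (\<xi> b - \<psi> b) * \<xi> a" for \<xi>
            by (rule factor_difference)
          ultimately have "(\<Sum>\<xi>\<in>insert \<psi> C. c \<xi> * (\<xi> b - \<psi> b) * \<xi> a) = 0"
            by (simp only:)
          then show "(\<Sum>\<xi>\<in>C. c \<xi> * (\<xi> b - \<psi> b) * \<xi> a) = 0"
            using insert.hyps by simp
        next
          show "C \<subseteq> range character"
            using insert.prems by blast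
        qed (fact \<xi>)
        then show ?thesis
          using b(2) by simp
      qed
      moreover have "c \<psi> = 0"
      proof -
        have "(\<Sum>\<xi>\<in>insert \<psi> C. c \<xi> * \<xi> (\<lambda>_. 1)) = c \<psi> * \<psi> (\<lambda>_. 1)"
          using insert.hyps calculation by simp
        moreover have "\<psi> (\<lambda>_. 1) = 1"
          using one by (simp add: n character_def monomial_value_def)
        ultimately show ?thesis
          using c[OF one] by simp
      qed
      ultimately have "c \<xi> = 0" if "\<xi> \<in> insert \<psi> C" for \<xi>
        using that by (metis insertE)
      then show "\<forall>\<xi>\<in>insert \<psi> C. c \<xi> = 0"
        by (rule ballI)
    qed
  qed
  then show ?thesis
    using assms(2,3) by blast
qed

text \<open>Grouping the monomials of \<open>p\<close> by the characters that they define gives a linear relation between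
distinct characters.\<close>

lemma vanishing_class_sum:
  assumes "\<And>a. a \<in> A \<Longrightarrow> eval_mpoly a p = 0"
  shows "(\<Sum>m | m \<in> keys p \<and> character m = \<chi>. lookup p m) = 0"
proof (cases "\<chi> \<in> character ` keys p")
  case True
  let ?c = "\<lambda>\<chi>. \<Sum>m | m \<in> keys p \<and> character m = \<chi>. lookup p m"
  have "(\<Sum>\<chi>\<in>character ` keys p. ?c \<chi> * \<chi> a) = 0" if a: "a \<in> A" for a
  proof -
    have "(\<Sum>m | m \<in> keys p \<and> character m = \<chi>. lookup p m * monomial_value a m) = ?c \<chi> * \<chi> a" for \<chi>
      unfolding sum_distrib_right by (rule sum.cong) (use a in \<open>auto simp: character_def\<close>)
    then have "(\<Sum>\<chi>\<in>character ` keys p. ?c \<chi> * \<chi> a) = eval_mpoly a p"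
      unfolding eval_mpoly_eq 
      using sum.image_gen[OF finite_keys, of "\<lambda>m. lookup p m * monomial_value a m" p character] by (simp only:)
    with assms[OF a] show ?thesis
      by (simp only:)
  qed
  then show ?thesis
    by (intro characters_independent[where C = "character ` keys p" and c = ?c]) (use True in auto)
next
  case False
  then have "{m. m \<in> keys p \<and> character m = \<chi>} = {}" by auto
  then show ?thesis by (simp only: sum.empty)
qed

lemma I_vanishes:
  assumes "p \<in> I" "a \<in> A"
  shows "eval_mpoly a p = 0"
  using assms(1) unfolding vanishing_ideal_def
proof (induction rule: ideal_gen_induct)
  case (step c b y)
  have "a \<in> proj_point a"
    unfolding proj_point_def by (rule CollectI, rule exI[of _ 1]) simp
  then have "eval_mpoly a b = 0"
    using step.hyps assms(2) by auto
  then show ?case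
    using step by (simp add: eval_mpoly_add eval_mpoly_mult)
qed simp

lemma in_I:
  assumes "p \<in> graded_part d" "\<And>a. a \<in> A \<Longrightarrow> eval_mpoly a p = 0"
  shows "p \<in> I"
proof -
  have "eval_mpoly b p = 0" if "a \<in> A" "b \<in> proj_point a" for a b
    using that assms(2) by (auto simp: proj_point_def eval_mpoly_scale_point[OF assms(1)])
  then show ?thesis
    using assms(1) unfolding vanishing_ideal_def ideal_gen_def
    by (intro ring_module.span_base) (auto simp: homogeneous_def)
qed

lemma binomial_in_I:
  assumes "character m = character n" "total_degree m = total_degree n"
  shows "single m 1 - single n 1 \<in> I"
proof (rule in_I)
  show "single m 1 - single n 1 \<in> graded_part (total_degree n)"
    using assms(2) by (intro graded_part_diff single_in_graded_part) simp_all
  show "eval_mpoly a (single m 1 - single n 1) = 0" if "a \<in> A" for a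
    using assms(1) that by (simp add: eval_mpoly_diff character_eq_iff)
qed

text \<open>A choice of one monomial for each character of degree \<open>d\<close> is a basis of the forms of degree \<open>d\<close>
modulo the ideal: independence is the vanishing of class sums, and every monomial is congruent to the
chosen monomial with the same character.\<close>

lemma hilbert_function_I: "hilbert_function I d = card (degree_characters d)"
proof -
  obtain R where R: "R \<subseteq> {m. total_degree m = d}" "inj_on character R"
    "degree_characters d = character ` R"
    using subset_image_inj[of "degree_characters d" character "{m. total_degree m = d}"]
    unfolding degree_characters_def by auto
  have finR: "finite R"
    using R(2) finite_imageD[of character R] by simp
  have inj: "inj_on (\<lambda>m. single m (1::'k)) R"
    by (rule inj_onI) (metis keys_single one_neq_zero singleton_iff)
  let ?B = "(\<lambda>m. single m (1::'k)) ` R"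
  have comb: "(\<Sum>b\<in>?B. scale_mpoly (c b) b) = (\<Sum>m\<in>R. single m (c (single m 1)))" for c
    by (simp add: sum.reindex[OF inj])
  have "quotient_basis (graded_part d) (I \<inter> graded_part d) ?B"
    unfolding quotient_basis_def comb
  proof (intro conjI allI impI ballI)
    show "finite ?B" using finR by simp
    show "?B \<subseteq> graded_part d"
      using R(1) by (auto intro: single_in_graded_part)
  next
    fix c :: "('s, 'k) mpoly \<Rightarrow> 'k" and b
    assume c: "(\<Sum>m\<in>R. single m (c (single m 1))) \<in> I \<inter> graded_part d"
      and "b \<in> ?B"
    then obtain n where n: "n \<in> R" "b = single n 1" by blast
    let ?p = "\<Sum>m\<in>R. single m (c (single m 1))"
    have lookup_p: "lookup ?p m = (if m \<in> R then c (single m 1) else 0)" for m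
      using finR by (simp add: lookup_sum lookup_single when_def)
    have "(\<Sum>m | m \<in> keys ?p \<and> character m = character n. lookup ?p m) = 0"
      using c I_vanishes by (intro vanishing_class_sum) blast
    moreover have "(\<Sum>m | m \<in> keys ?p \<and> character m = character n. lookup ?p m) = (\<Sum>m\<in>{n}. lookup ?p m)"
    proof (rule sum.mono_neutral_left)
      show "{m. m \<in> keys ?p \<and> character m = character n} \<subseteq> {n}"
        using n(1) inj_onD[OF R(2)] by (auto simp: in_keys_iff lookup_p split: if_splits)
    qed (auto simp: in_keys_iff)
    ultimately show "c b = 0"
      using n by (simp add: lookup_p)
  next
    fix u :: "('s, 'k) mpoly" assume u: "u \<in> graded_part d"
    let ?r = "\<lambda>m. the_inv_into R character (character m)"
    have r: "?r m \<in> R" "character (?r m) = character m" if "m \<in> keys u" for m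
    proof -
      have "character m \<in> character ` R"
        using u that R(3) by (auto simp: graded_part_def degree_characters_def)
      then show "?r m \<in> R" "character (?r m) = character m"
        using R(2) by (auto simp: the_inv_into_f_f)
    qed
    let ?c = "\<lambda>n. \<Sum>m | m \<in> keys u \<and> ?r m = n. lookup u m"
    define c where "c b = ?c (the_inv_into R (\<lambda>m. single m (1::'k)) b)" for b
    have c: "c (single n 1) = ?c n" if "n \<in> R" for n
      by (simp add: c_def the_inv_into_f_f[OF inj that])
    let ?v = "\<Sum>m\<in>R. single m (c (single m 1))"
    have v: "?v \<in> graded_part d"
      unfolding comb[symmetric]
      by (rule graded_part_combination) (use R(1) in \<open>auto intro: single_in_graded_part\<close>)
    have "eval_mpoly a ?v = eval_mpoly a u" if a: "a \<in> A" for a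
    proof -
      have "eval_mpoly a ?v = (\<Sum>n\<in>R. ?c n * monomial_value a n)"
        by (simp add: eval_mpoly_sum c)
      also have "\<dots> = (\<Sum>n\<in>R. \<Sum>m | m \<in> keys u \<and> ?r m = n. lookup u m * monomial_value a m)"
      proof (rule sum.cong[OF refl])
        fix n assume "n \<in> R"
        have "monomial_value a m = monomial_value a n" if "m \<in> keys u" "?r m = n" for m
          using r(2)[OF that(1)] that(2) a by (auto simp: character_eq_iff)
        then show "?c n * monomial_value a n =
            (\<Sum>m | m \<in> keys u \<and> ?r m = n. lookup u m * monomial_value a m)"
          unfolding sum_distrib_right by (intro sum.cong) auto
      qed
      also have "\<dots> = eval_mpoly a u"
        unfolding eval_mpoly_eq by (rule sum.group) (use finR r in auto)
      finally show ?thesis .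
    qed
    then have "u - ?v \<in> I \<inter> graded_part d"
      using graded_part_diff[OF u v] in_I[OF graded_part_diff[OF u v]] by (simp add: eval_mpoly_diff)
    then show "\<exists>c. u - (\<Sum>m\<in>R. single m (c (single m (1 :: 'k)))) \<in> I \<inter> graded_part d"
      by (rule exI[of _ c])
  qed
  then have "hilbert_function I d = card ?B"
    by (rule hilbert_function_eq_card)
      (auto simp: vanishing_ideal_def ideal_gen_def ring_module.span_zero ring_module.span_diff)
  then show ?thesis
    by (simp add: R(3) card_image inj R(2))
qed

section \<open>Stabilisation of the Hilbert function\<close>

lemma character_add_cong: "character m = character m' \<Longrightarrow> character (n + m) = character (n + m')"
  by (simp add: character_eq_iff monomial_value_add)

lemma character_single_period: "character (single i (CARD('k) - 1)) = character (single j (CARD('k) - 1))"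
  using nonzero by (simp add: character_eq_iff finite_field_power_pred_card del: One_nat_def)

text \<open>The effect on characters of multiplying a monomial by \<open>t\<^sub>i\<close>.\<close>

definition shift :: "'s \<Rightarrow> (('s \<Rightarrow> 'k) \<Rightarrow> 'k) \<Rightarrow> ('s \<Rightarrow> 'k) \<Rightarrow> 'k" where
  "shift i \<chi> = restrict (\<lambda>a. \<chi> a * a i) A"

lemma shift_character: "shift i (character m) = character (m + single i 1)"
  by (auto simp: shift_def character_def fun_eq_iff restrict_def monomial_value_add)

lemma inj_on_shift: "inj_on (shift i) (degree_characters d)"
proof (rule inj_onI)
  fix \<chi> \<psi>
  assume "\<chi> \<in> degree_characters d" "\<psi> \<in> degree_characters d" and eq: "shift i \<chi> = shift i \<psi>"
  then obtain m n where mn: "\<chi> = character m" "\<psi> = character n"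
    by (auto simp: degree_characters_def)
  have "monomial_value a m = monomial_value a n" if "a \<in> A" for a
    using eq nonzero[OF that, of i] that
    by (auto simp: mn shift_character character_eq_iff monomial_value_add)
  then show "\<chi> = \<psi>"
    by (simp add: mn character_eq_iff)
qed

lemma shift_subset: "shift i ` degree_characters d \<subseteq> degree_characters (Suc d)"
proof
  fix \<chi> assume "\<chi> \<in> shift i ` degree_characters d"
  then obtain m where m: "total_degree m = d" "\<chi> = character (m + single i 1)"
    by (auto simp: degree_characters_def shift_character)
  then have "total_degree (m + single i 1) = Suc d"
    by (simp only: total_degree_add total_degree_single)
  then show "\<chi> \<in> degree_characters (Suc d)"
    using m(2) by (auto simp: degree_characters_def)
qed

text \<open>A monomial of degree greater than \<open>(q - 2)(s - 1)\<close> without \<open>t\<^sub>i\<close> has, by the pigeonhole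
principle, an exponent of at least \<open>q - 1\<close>; replacing that \<open>(q - 1)\<close>-st power by one of \<open>t\<^sub>i\<close> keeps the
character.\<close>

lemma shift_surj:
  assumes "d \<ge> (CARD('k) - 2) * (CARD('s) - 1)"
  shows "shift i ` degree_characters d = degree_characters (Suc d)"
proof (rule equalityI[OF shift_subset], rule subsetI)
  fix \<chi> assume "\<chi> \<in> degree_characters (Suc d)"
  then obtain m where m: "total_degree m = Suc d" "\<chi> = character m"
    by (auto simp: degree_characters_def)
  have "\<exists>n. \<chi> = character (n + single i 1) \<and> total_degree (n + single i 1) = Suc d"
  proof (cases "lookup m i = 0")
    case False
    then obtain n where "m = n + single i 1"
      using exponent_split[of 1 m i] by auto
    then show ?thesis using m by blast
  next
    case True
    have q: "CARD('k) - 1 = Suc (CARD('k) - 2)"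
      using finite_field_card_ge_2[where 'k = 'k] by simp
    obtain j where j: "CARD('k) - 1 \<le> lookup m j"
    proof (rule ccontr)
      assume "\<not> thesis"
      then have "lookup m j \<le> CARD('k) - 2" for j
        using that[of j] q by linarith
      then have "(\<Sum>j\<in>UNIV - {i}. lookup m j) \<le> (\<Sum>j\<in>UNIV - {i}. CARD('k) - 2)"
        by (rule sum_mono)
      moreover have "(\<Sum>j\<in>UNIV - {i}. CARD('k) - 2) = (CARD('k) - 2) * (CARD('s) - 1)"
        unfolding sum_constant of_nat_id by (subst mult.commute) (simp add: card_Diff_singleton)
      moreover have "total_degree m = lookup m i + (\<Sum>j\<in>UNIV - {i}. lookup m j)"
        by (rule sum.remove) auto
      ultimately show False
        using True m(1) assms by linarith
    qed
    then obtain n where n: "m = n + single j (CARD('k) - 1)"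
      by (rule exponent_split)
    have split: "single i (CARD('k) - 1) = single i (CARD('k) - 2) + single i 1"
      unfolding single_add[symmetric] q by simp
    have "character m = character ((n + single i (CARD('k) - 2)) + single i 1)"
      unfolding n add.assoc split[symmetric] by (rule character_add_cong[OF character_single_period])
    moreover have "total_degree ((n + single i (CARD('k) - 2)) + single i 1) = total_degree m"
      unfolding n total_degree_add total_degree_single q by simp
    ultimately show ?thesis
      using m by auto
  qed
  then obtain n where n: "\<chi> = character (n + single i 1)" "total_degree (n + single i 1) = Suc d"
    by blast
  from n(2) have "total_degree n = d"
    by (simp only: total_degree_add total_degree_single)
  then show "\<chi> \<in> shift i ` degree_characters d"
    using n(1) unfolding degree_characters_def shift_character[symmetric] by blast
qed

lemma degree_characters_stable:
  assumes "d \<ge> (CARD('k) - 2) * (CARD('s) - 1)"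
  shows "card (degree_characters d) = card (degree_characters ((CARD('k) - 2) * (CARD('s) - 1)))"
  using assms
proof (induction rule: dec_induct)
  case (step d)
  obtain i :: 's where True by blast
  have "card (degree_characters (Suc d)) = card (degree_characters d)"
    unfolding shift_surj[OF step.hyps(1), of i, symmetric] by (rule card_image[OF inj_on_shift])
  then show ?case
    using step.IH by (simp only:)
qed (rule refl)

lemma regularity_le_degree: "regularity I \<le> (CARD('k) - 2) * (CARD('s) - 1)"
  by (rule regularity_le) (unfold hilbert_function_I, rule degree_characters_stable)

end

section \<open>Complete intersections\<close>

text \<open>The one-parameter subgroups \<open>x \<mapsto> (\<lambda>k. x ^ e k)\<close> are all that the proof retains of the clutter.\<close>

locale separating_torus_subgroup = torus_subgroup A
  for A :: "('s::finite \<Rightarrow> 'k::{field,finite}) set" +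
  assumes separating: "i \<noteq> j \<Longrightarrow>
    \<exists>e. e i = 1 \<and> e j = 0 \<and> (\<forall>k. e k \<le> (1::nat)) \<and> (\<forall>x. x \<noteq> 0 \<longrightarrow> (\<lambda>k. x ^ e k) \<in> A)"
begin

text \<open>On a separating one-parameter subgroup, \<open>t\<^sub>i\<^sup>d\<close> becomes \<open>x\<^sup>d\<close>, whereas any other monomial
of degree \<open>d\<close> loses the exponent of some \<open>t\<^sub>j\<close> and becomes a smaller power of \<open>x\<close>. Two such powers agree
on all nonzero \<open>x\<close> only if \<open>d \<ge> q - 1\<close>.\<close>

lemma character_single_unique:
  assumes d: "d < CARD('k) - 1" and m: "total_degree m = d" "character m = character (single i d)"
  shows "m = single i d"
proof (rule ccontr)
  assume "m \<noteq> single i d"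
  \<comment> \<open>The total degrees agree, so a monomial other than the pure power contains another variable.\<close>
  have "\<exists>j. j \<noteq> i \<and> lookup m j \<noteq> 0"
  proof (rule ccontr)
    assume "\<not> ?thesis"
    then have "m = single i (lookup m i)"
      by (intro poly_mapping_eqI) (auto simp: lookup_single when_def)
    then show False
      using m(1) \<open>m \<noteq> single i d\<close> by (metis total_degree_single)
  qed
  then obtain j where j: "j \<noteq> i" "lookup m j \<noteq> 0" by blast
  obtain e where e: "e i = 1" "e j = 0" "\<And>k. e k \<le> (1::nat)" "\<And>x. x \<noteq> 0 \<Longrightarrow> (\<lambda>k. x ^ e k) \<in> A"
    using separating[of i j] j(1) by metis
  have "x ^ d = x ^ (\<Sum>k\<in>UNIV. e k * lookup m k)" if "x \<noteq> 0" for x :: 'k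
  proof -
    have "monomial_value (\<lambda>k. x ^ e k) m = monomial_value (\<lambda>k. x ^ e k) (single i d)"
      using m(2) e(4)[OF that] by (simp only: character_eq_iff)
    also have "\<dots> = x ^ d"
      by (simp only: monomial_value_single e(1) power_one_right)
    finally show ?thesis
      by (simp add: monomial_value_def power_mult[symmetric] power_sum)
  qed
  moreover have "(\<Sum>k\<in>UNIV. e k * lookup m k) < d"
    unfolding m(1)[symmetric]
  proof (rule sum_strict_mono_ex1)
    show "\<forall>k\<in>UNIV. e k * lookup m k \<le> lookup m k"
      using e(3) mult_le_mono1 by fastforce
    show "\<exists>k\<in>UNIV. e k * lookup m k < lookup m k"
      using j(2) e(2) by (intro bexI[of _ j]) auto
  qed simp
  ultimately have "CARD('k) - 1 \<le> d"
    by (rule finite_field_power_eq_imp)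
  then show False
    using d by simp
qed

text \<open>A pure power of low degree is alone in its character class, so its coefficient is the whole class sum.\<close>

lemma no_low_pure_power:
  assumes "p \<in> I" "homogeneous p" "d < CARD('k) - 1"
  shows "lookup p (single i d) = 0"
proof (rule ccontr)
  assume nz: "lookup p (single i d) \<noteq> 0"
  obtain e where e: "p \<in> graded_part e"
    using assms(2) by (auto simp: homogeneous_def)
  then have "e = d"
    using graded_partD[of p e "single i d"] nz by auto
  have "{m. m \<in> keys p \<and> character m = character (single i d)} = {single i d}"
  proof (intro equalityI subsetI)
    fix m assume "m \<in> {m. m \<in> keys p \<and> character m = character (single i d)}"
    moreover from this have "total_degree m = d"
      using e \<open>e = d\<close> by (auto simp: graded_part_def)
    ultimately show "m \<in> {single i d}"
      using character_single_unique[OF assms(3)] by blast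
  qed (use nz in \<open>auto simp: in_keys_iff\<close>)
  moreover have "(\<Sum>m | m \<in> keys p \<and> character m = character (single i d). lookup p m) = 0"
    using I_vanishes[OF assms(1)] by (rule vanishing_class_sum)
  ultimately show False
    using nz by simp
qed

context
  fixes g :: "nat \<Rightarrow> ('s, 'k) mpoly"
  assumes generators: "I = ideal_gen (g ` {..<CARD('s) - 1})"
    and homogeneous: "k < CARD('s) - 1 \<Longrightarrow> homogeneous (g k)"
begin

lemma generator_in_I: "k < CARD('s) - 1 \<Longrightarrow> g k \<in> I"
  unfolding generators ideal_gen_def by (intro ring_module.span_base) auto

text \<open>A proper factorisation of \<open>t\<^sub>i\<^sup>q\<^sup>-\<^sup>1\<close> involves a lower power of \<open>t\<^sub>i\<close>, which no generator contains.\<close>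

lemma lookup_generator_multiple_pure:
  assumes k: "k < CARD('s) - 1"
  shows "lookup (h * g k) (single i (CARD('k) - 1)) = lookup h 0 * lookup (g k) (single i (CARD('k) - 1))"
proof (rule lookup_mult_constant)
  fix a b assume ab: "single i (CARD('k) - 1) = a + b" "a \<noteq> 0"
  note split = single_eq_addD[OF ab(1)]
  have "lookup b i < CARD('k) - 1"
    using split(2,3) ab(2) by linarith
  then have "lookup (g k) (single i (lookup b i)) = 0"
    by (rule no_low_pure_power[OF generator_in_I[OF k] homogeneous[OF k]])
  then show "lookup (g k) b = 0"
    using split(1) by simp
qed

text \<open>The matrix \<open>C\<close> has the constant terms of the multipliers that express the binomials \<open>F\<^sub>j\<close> through
the generators, and \<open>P\<close> has the coefficients of the generators at the pure powers of degree \<open>q - 1\<close>.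
From \<open>C P = 1\<close> follows \<open>P C = 1\<close>, as both are square; this is where the number \<open>s - 1\<close> of generators
enters. Hence no row of \<open>P\<close> is zero, so that all generators have degree \<open>q - 1\<close>, and then each generator
is the combination of the \<open>F\<^sub>j\<close> whose coefficients form its row of \<open>P\<close>.\<close>

lemma generator_support:
  assumes k: "k < CARD('s) - 1" and "lookup (g k) m \<noteq> 0"
  shows "\<exists>i. m = single i (CARD('k) - 1)"
proof -
  let ?n = "CARD('s) - 1" and ?q = "CARD('k) - 1"
  obtain i0 :: 's where True by blast
  have "card {..<?n} = card (UNIV - {i0})"
    by (simp add: card_Diff_singleton)
  then obtain \<beta> where \<beta>: "bij_betw \<beta> {..<?n} (UNIV - {i0})"
    using finite_same_card_bij[of "{..<?n}" "UNIV - {i0}"] by auto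
  define F :: "nat \<Rightarrow> ('s, 'k) mpoly" where "F j = single (single (\<beta> j) ?q) 1 - single (single i0 ?q) 1" for j
  have F_in: "F j \<in> I" for j
    unfolding F_def by (rule binomial_in_I[OF character_single_period]) (simp only: total_degree_single)
  have "\<forall>j. \<exists>h. F j = (\<Sum>k<?n. h k * g k)"
    using ideal_gen_image_obtain[OF F_in[unfolded generators]] by blast
  then have "\<exists>h. \<forall>j. F j = (\<Sum>k<?n. h j k * g k)"
    by (rule choice)
  then obtain h where h: "\<And>j. F j = (\<Sum>k<?n. h j k * g k)"
    by blast
  define C where "C = mat ?n ?n (\<lambda>(j, k). lookup (h j k) 0)"
  define P where "P = mat ?n ?n (\<lambda>(k, i). lookup (g k) (single (\<beta> i) ?q))"
  have "C * P = 1\<^sub>m ?n"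
  proof (rule eq_matI)
    fix j i assume "j < dim_row (1\<^sub>m ?n :: 'k mat)" "i < dim_col (1\<^sub>m ?n :: 'k mat)"
    then have ji: "j < ?n" "i < ?n" by simp_all
    have "(C * P) $$ (j, i) = (\<Sum>k<?n. lookup (h j k) 0 * lookup (g k) (single (\<beta> i) ?q))"
      using ji by (simp add: C_def P_def scalar_prod_def atLeast0LessThan)
    also have "\<dots> = lookup (F j) (single (\<beta> i) ?q)"
      unfolding h lookup_sum by (rule sum.cong[OF refl]) (simp only: lookup_generator_multiple_pure lessThan_iff)
    also have "\<dots> = (if i = j then 1 else 0)"
    proof -
      have "?q > 0"
        using finite_field_card_ge_2[where 'k = 'k] by simp
      moreover have "\<beta> i \<noteq> i0"
        using \<beta> ji(2) by (auto simp: bij_betw_def)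
      moreover have "\<beta> i = \<beta> j \<longleftrightarrow> i = j"
        using \<beta> ji by (auto simp: bij_betw_def inj_on_def)
      moreover have "single x ?q = single y ?q \<longleftrightarrow> x = y" for x y :: 's
        using \<open>?q > 0\<close> by (metis lookup_single_eq lookup_single_not_eq less_irrefl)
      ultimately show ?thesis
        unfolding F_def lookup_minus lookup_single when_def by auto
    qed
    finally show "(C * P) $$ (j, i) = 1\<^sub>m ?n $$ (j, i)"
      using ji by auto
  qed (simp_all add: C_def P_def)
  moreover have carrier: "C \<in> carrier_mat ?n ?n" "P \<in> carrier_mat ?n ?n"
    by (simp_all add: C_def P_def)
  ultimately have PC: "P * C = 1\<^sub>m ?n"
    using mat_mult_left_right_inverse by blast
  have PC_entry: "(\<Sum>i<?n. P $$ (l, i) * C $$ (i, k)) = (if l = k then 1 else 0)"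
    if "l < ?n" "k < ?n" for l k
  proof -
    have "(P * C) $$ (l, k) = (\<Sum>i<?n. P $$ (l, i) * C $$ (i, k))"
      using that carrier by (simp add: scalar_prod_def atLeast0LessThan)
    then show ?thesis
      using PC that by simp
  qed
  \<comment> \<open>A zero row of \<open>P\<close> would contradict \<open>P C = 1\<close> on the diagonal.\<close>
  have degree: "g l \<in> graded_part ?q" if l: "l < ?n" for l
  proof -
    obtain i where i: "i < ?n" "P $$ (l, i) \<noteq> 0"
    proof (rule ccontr)
      assume "\<not> thesis"
      then have "P $$ (l, i) = 0" if "i < ?n" for i
        using that \<open>\<And>i. i < ?n \<Longrightarrow> P $$ (l, i) \<noteq> 0 \<Longrightarrow> thesis\<close> by blast
      then have "(\<Sum>i<?n. P $$ (l, i) * C $$ (i, l)) = 0"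
        by simp
      then show False
        using PC_entry[OF l l] by simp
    qed
    then have "lookup (g l) (single (\<beta> i) ?q) \<noteq> 0"
      using l by (simp add: P_def)
    moreover obtain e where "g l \<in> graded_part e"
      using homogeneous[OF l] by (auto simp: homogeneous_def)
    ultimately show ?thesis
      using graded_partD[of "g l" e "single (\<beta> i) ?q"] by auto
  qed
  have total: "total_degree m = ?q"
    using degree[OF k] assms(2) graded_partD by blast
  \<comment> \<open>All degrees are now \<open>q - 1\<close>, so again only constant terms of the multipliers contribute.\<close>
  have F_m: "lookup (F j) m = (\<Sum>l<?n. C $$ (j, l) * lookup (g l) m)" if j: "j < ?n" for j
    unfolding h lookup_sum
  proof (rule sum.cong[OF refl])
    fix l assume "l \<in> {..<?n}"
    then have l: "l < ?n" by simp
    have "lookup (h j l * g l) m = lookup (h j l) 0 * lookup (g l) m"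
    proof (rule lookup_mult_constant)
      fix a b :: "'s \<Rightarrow>\<^sub>0 nat" assume ab: "m = a + b" "a \<noteq> 0"
      have "total_degree a + total_degree b = ?q"
        using total unfolding ab(1) total_degree_add .
      moreover have "total_degree a \<noteq> 0"
        using ab(2) total_degree_eq_0_iff by blast
      ultimately have "total_degree b \<noteq> ?q"
        by linarith
      then show "lookup (g l) b = 0"
        by (rule graded_partD[OF degree[OF l]])
    qed
    then show "lookup (h j l * g l) m = C $$ (j, l) * lookup (g l) m"
      using j l by (simp add: C_def)
  qed
  have "(\<Sum>j<?n. P $$ (k, j) * lookup (F j) m) = (\<Sum>j<?n. \<Sum>l<?n. P $$ (k, j) * C $$ (j, l) * lookup (g l) m)"
    by (rule sum.cong[OF refl]) (simp only: F_m lessThan_iff sum_distrib_left mult.assoc)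
  also have "\<dots> = (\<Sum>l<?n. (\<Sum>j<?n. P $$ (k, j) * C $$ (j, l)) * lookup (g l) m)"
    unfolding sum_distrib_right by (rule sum.swap)
  also have "\<dots> = (\<Sum>l<?n. if k = l then lookup (g l) m else 0)"
    by (rule sum.cong[OF refl]) (simp add: PC_entry[OF k] del: One_nat_def)
  also have "\<dots> = lookup (g k) m"
    using k by (simp del: One_nat_def)
  finally have "(\<Sum>j<?n. P $$ (k, j) * lookup (F j) m) \<noteq> 0"
    using assms(2) by simp
  then obtain j where "P $$ (k, j) * lookup (F j) m \<noteq> 0"
    by (rule sum.not_neutral_contains_not_neutral)
  then have "lookup (F j) m \<noteq> 0" by auto
  then show ?thesis
    unfolding F_def lookup_minus lookup_single when_def by (auto split: if_splits)
qed

lemma lookup_I_eq_0: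
  assumes "p \<in> I" and m: "\<And>i. lookup m i < CARD('k) - 1"
  shows "lookup p m = 0"
  using assms(1) unfolding generators
proof (induction rule: ideal_gen_induct)
  case (step c b y)
  then obtain k where k: "k < CARD('s) - 1" "b = g k" by auto
  have "lookup (c * b) m = 0"
  proof (rule lookup_mult_eq_0, rule ccontr)
    fix a l assume al: "m = a + l" "lookup b l \<noteq> 0"
    then obtain i where "l = single i (CARD('k) - 1)"
      using generator_support[OF k(1)] k(2) by blast
    then have "lookup m i \<ge> CARD('k) - 1"
      by (simp add: al(1) lookup_add)
    then show False
      using m[of i] by simp
  qed
  then show ?case
    using step.IH by (simp add: lookup_add)
qed simp

text \<open>The witness is \<open>M\<close>, the product of all \<open>t\<^sub>i\<^sup>q\<^sup>-\<^sup>2\<close> with \<open>i \<noteq> i0\<close>. If its character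
came from degree \<open>d\<close>, then \<open>M\<close> would occur in an element of the ideal, namely in its difference
from a monomial divisible by the variable of index \<open>i0\<close>.\<close>

lemma degree_characters_strict:
  assumes "Suc d = (CARD('k) - 2) * (CARD('s) - 1)"
  shows "card (degree_characters d) < card (degree_characters (Suc d))"
proof -
  obtain i0 :: 's where True by blast
  define M :: "'s \<Rightarrow>\<^sub>0 nat" where "M = (\<Sum>i\<in>UNIV - {i0}. single i (CARD('k) - 2))"
  have lookup_M: "lookup M i = (if i = i0 then 0 else CARD('k) - 2)" for i
    unfolding M_def lookup_sum lookup_single when_def by simp
  have total_M: "total_degree M = Suc d"
  proof -
    have "total_degree M = (\<Sum>i\<in>UNIV - {i0}. lookup M i)"
      by (rule sum.mono_neutral_right) (auto simp: lookup_M)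
    also have "\<dots> = (\<Sum>i\<in>UNIV - {i0}. CARD('k) - 2)"
      by (rule sum.cong) (auto simp: lookup_M)
    also have "\<dots> = (CARD('s) - 1) * (CARD('k) - 2)"
      unfolding sum_constant of_nat_id by (simp add: card_Diff_singleton)
    finally show ?thesis
      by (simp only: assms mult.commute)
  qed
  have "character M \<notin> shift i0 ` degree_characters d"
  proof
    assume "character M \<in> shift i0 ` degree_characters d"
    then obtain n where n: "total_degree n = d" "character M = character (n + single i0 1)"
      by (auto simp: degree_characters_def shift_character)
    have "total_degree M = total_degree (n + single i0 1)"
      unfolding total_degree_add total_degree_single n(1) total_M by simp
    then have "single M 1 - single (n + single i0 1) 1 \<in> I"
      by (rule binomial_in_I[OF n(2)])
    moreover have "lookup M i < CARD('k) - 1" for i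
      using finite_field_card_ge_2[where 'k = 'k] lookup_M[of i] by (auto split: if_splits)
    ultimately have "lookup (single M 1 - single (n + single i0 1) (1::'k)) M = 0"
      by (rule lookup_I_eq_0)
    moreover have "n + single i0 1 \<noteq> M"
      using lookup_M[of i0] by (auto simp: lookup_add)
    ultimately show False
      by (simp add: lookup_minus lookup_single)
  qed
  moreover have "character M \<in> degree_characters (Suc d)"
    using total_M unfolding degree_characters_def by blast
  ultimately have "shift i0 ` degree_characters d \<subset> degree_characters (Suc d)"
    using shift_subset by blast
  then have "card (shift i0 ` degree_characters d) < card (degree_characters (Suc d))"
    by (rule psubset_card_mono[OF finite])
  then show ?thesis
    by (simp only: card_image[OF inj_on_shift])
qed

end

end

lemma (in separating_torus_subgroup) regularity_complete_intersection:
  assumes "complete_intersection I"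
  shows "regularity I = (CARD('k) - 2) * (CARD('s) - 1)"
proof (rule antisym[OF regularity_le_degree])
  obtain g where g: "I = ideal_gen (g ` {..<CARD('s) - 1})" "\<And>k. k < CARD('s) - 1 \<Longrightarrow> homogeneous (g k)"
    using assms unfolding complete_intersection_def by blast
  show "(CARD('k) - 2) * (CARD('s) - 1) \<le> regularity I"
  proof (cases "(CARD('k) - 2) * (CARD('s) - 1)")
    case (Suc d)
    have "regularity I > d"
    proof (rule regularity_gt)
      show "hilbert_function I e = card (degree_characters (Suc d))" if "e \<ge> Suc d" for e
        using degree_characters_stable[of e] that unfolding hilbert_function_I Suc by blast
      show "hilbert_function I d \<noteq> card (degree_characters (Suc d))"
        using degree_characters_strict[OF g] Suc unfolding hilbert_function_I by fastforce
    qed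
    then show ?thesis
      unfolding Suc by simp
  next
    case 0
    then show ?thesis
      by (simp only: le0)
  qed
qed

section \<open>The toric set of a clutter\<close>

definition monomial_parameter_vectors :: "'v set \<Rightarrow> ('s \<Rightarrow> 'v \<Rightarrow> nat) \<Rightarrow> ('s \<Rightarrow> 'k::field) set" where
  "monomial_parameter_vectors Y v = {\<lambda>i. \<Prod>y\<in>Y. x y ^ v i y | x. \<forall>y\<in>Y. x y \<noteq> 0}"

lemma toric_set_eq_image: "toric_set Y v = proj_point ` monomial_parameter_vectors Y v"
  by (auto simp: toric_set_def monomial_parameter_vectors_def)

text \<open>A vertex \<open>y\<close> of the \<open>i\<close>-th edge outside the \<open>j\<close>-th edge exists because the edges are pairwise
incomparable. Setting all parameters except the one of \<open>y\<close> to \<open>1\<close> gives the separating subgroup, with the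
incidences of \<open>y\<close> as exponents.\<close>

lemma clutter_separating_torus_subgroup:
  fixes v :: "'s::finite \<Rightarrow> 'v \<Rightarrow> nat"
  assumes clutter: "clutter Y E" and v: "bij_betw v UNIV (indicator ` E)"
  shows "separating_torus_subgroup (monomial_parameter_vectors Y v :: ('s \<Rightarrow> 'k::{field,finite}) set)"
proof
  have Y: "finite Y"
    using clutter by (simp add: clutter_def)
  let ?A = "monomial_parameter_vectors Y v :: ('s \<Rightarrow> 'k) set"
  show "(\<lambda>_. 1) \<in> ?A"
    unfolding monomial_parameter_vectors_def by (rule CollectI, rule exI[of _ "\<lambda>_. 1"]) simp
  show "(\<lambda>i. a i * b i) \<in> ?A" if "a \<in> ?A" "b \<in> ?A" for a b
  proof -
    obtain x z where xz: "a = (\<lambda>i. \<Prod>y\<in>Y. x y ^ v i y)" "\<forall>y\<in>Y. x y \<noteq> 0"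
      "b = (\<lambda>i. \<Prod>y\<in>Y. z y ^ v i y)" "\<forall>y\<in>Y. z y \<noteq> 0"
      using \<open>a \<in> ?A\<close> \<open>b \<in> ?A\<close> unfolding monomial_parameter_vectors_def by blast
    then show ?thesis
      unfolding monomial_parameter_vectors_def
      by (intro CollectI exI[of _ "\<lambda>y. x y * z y"]) (simp add: power_mult_distrib prod.distrib)
  qed
  show "a i \<noteq> 0" if "a \<in> ?A" for a i
    using that Y by (auto simp: monomial_parameter_vectors_def)
  show "\<exists>e. e i = 1 \<and> e j = 0 \<and> (\<forall>k. e k \<le> (1::nat)) \<and> (\<forall>x. x \<noteq> 0 \<longrightarrow> (\<lambda>k. x ^ e k) \<in> ?A)"
    if "i \<noteq> j" for i j
  proof -
    have "v k \<in> indicator ` E" for k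
      using v by (auto simp: bij_betw_def)
    then have "\<forall>k. \<exists>f. f \<in> E \<and> v k = indicator f"
      by blast
    then have "\<exists>f. \<forall>k. f k \<in> E \<and> v k = indicator (f k)"
      by (rule choice)
    then obtain f where f: "\<And>k. f k \<in> E" "\<And>k. v k = indicator (f k)"
      by blast
    have "f i \<noteq> f j"
      using v \<open>i \<noteq> j\<close> f(2)[of i] f(2)[of j] by (auto simp: bij_betw_def inj_on_def)
    then have "\<not> f i \<subseteq> f j" "f i \<subseteq> Y"
      using clutter f(1) by (auto simp: clutter_def)
    then obtain y where y: "y \<in> f i" "y \<notin> f j" "y \<in> Y"
      by blast
    have "(\<lambda>k. x ^ v k y) \<in> ?A" if "x \<noteq> 0" for x :: 'k
    proof -
      have "(\<Prod>z\<in>Y. (if z = y then x else 1) ^ v k z) = x ^ v k y" for k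
      proof -
        have "(\<Prod>z\<in>Y. (if z = y then x else 1) ^ v k z) = (\<Prod>z\<in>Y. if z = y then x ^ v k y else 1)"
          by (rule prod.cong) auto
        then show ?thesis
          using Y y(3) by simp
      qed
      then show ?thesis
        using that unfolding monomial_parameter_vectors_def
        by (intro CollectI exI[of _ "\<lambda>z. if z = y then x else 1"]) simp
    qed
    moreover have "v i y = 1" "v j y = 0" "\<And>k. v k y \<le> 1"
      using y by (simp_all add: f(2) indicator_def)
    ultimately show ?thesis
      by (intro exI[of _ "\<lambda>k. v k y"]) simp
  qed
qed

theorem proposition4p6:
  fixes Y :: "'v set" and E :: "'v set set"
    and v :: "'s::finite \<Rightarrow> 'v \<Rightarrow> nat"
    and X :: "('s \<Rightarrow> 'k::{field,finite}) set set"
  assumes "clutter Y E"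
    and "bij_betw v UNIV (indicator ` E)"
    and "X = toric_set Y v"
  shows "regularity (vanishing_ideal X) \<le> (CARD('k) - 2) * (CARD('s) - 1) \<and>
    (complete_intersection (vanishing_ideal X) \<longrightarrow>
       regularity (vanishing_ideal X) = (CARD('k) - 2) * (CARD('s) - 1))"
proof -
  interpret separating_torus_subgroup "monomial_parameter_vectors Y v :: ('s \<Rightarrow> 'k) set"
    using assms(1,2) by (rule clutter_separating_torus_subgroup)
  show ?thesis
    unfolding assms(3) toric_set_eq_image
    using regularity_le_degree regularity_complete_intersection by blast
qed

end
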